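(* Let $p$ be a prime, $S$ a finite $p$-group, and $A$ an abelian subgroup of $S$. Suppose $N_S(A)$ is maximal under inclusion among all the groups $N_S(A^* )$, where $A^*$ ranges over the abelian subgroups of $S$ with $|A^*|=|A|$. Then $A$ centralizes $D^*(S)$.
   Context: All groups are finite. For a $p$-group $S$, $D^*(S)$ (the Glauberman–Solomon subgroup) is defined as the unique largest normal subgroup of $S$ with the property that it centralizes every abelian subgroup of $S$ that it normalizes. *)

theory Defs
  imports "HOL-Algebra.Algebra" "HOL-Computational_Algebra.Primes"
begin

definition finite_p_group :: "nat \<Rightarrow> ('a, 'b) monoid_scheme \<Rightarrow> bool" where
  "finite_p_group p S \<longleftrightarrow> group S \<and> finite (carrier S) \<and> (\<exists>n. order S = p ^ n)"

(* Not to be confused with the locale abelian_subgroup of HOL-Algebra, which is about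
   additive subgroups of rings. *)
definition comm_subgroup :: "'a set \<Rightarrow> ('a, 'b) monoid_scheme \<Rightarrow> bool" where
  "comm_subgroup B S \<longleftrightarrow> subgroup B S \<and> comm_group (S\<lparr>carrier := B\<rparr>)"

definition centralizer :: "('a, 'b) monoid_scheme \<Rightarrow> 'a set \<Rightarrow> 'a set" where
  "centralizer S B = {g \<in> carrier S. \<forall>b \<in> B. g \<otimes>\<^bsub>S\<^esub> b = b \<otimes>\<^bsub>S\<^esub> g}"

definition centralizes_normalized_comm :: "('a, 'b) monoid_scheme \<Rightarrow> 'a set \<Rightarrow> bool" where
  "centralizes_normalized_comm S D \<longleftrightarrow>
     (\<forall>B. comm_subgroup B S \<and> D \<subseteq> normalizer S B \<longrightarrow> D \<subseteq> centralizer S B)"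

(* The Glauberman-Solomon subgroup. GREATEST refers to the inclusion order on sets;
   glauberman_solomon_greatest below shows that the greatest element exists. *)
definition glauberman_solomon :: "('a, 'b) monoid_scheme \<Rightarrow> 'a set"  (\<open>D\<^sup>*\<close>) where
  "D\<^sup>* S = (GREATEST D. D \<lhd> S \<and> centralizes_normalized_comm S D)"

lemma (in group) subgroup_centralizer:
  assumes "B \<subseteq> carrier G"
  shows "subgroup (centralizer G B) G"
proof (rule subgroupI)
  show "centralizer G B \<noteq> {}"
    using assms by (auto simp: centralizer_def intro!: exI[of _ \<one>])
next
  fix a assume a: "a \<in> centralizer G B"
  have "inv a \<otimes> b = b \<otimes> inv a" if b: "b \<in> B" for b
  proof -
    have c: "a \<in> carrier G" "b \<in> carrier G" "a \<otimes> b = b \<otimes> a"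
      using a b assms by (auto simp: centralizer_def)
    have "inv a \<otimes> b = inv a \<otimes> (b \<otimes> a) \<otimes> inv a"
      using c(1,2) by (simp add: m_assoc)
    also have "\<dots> = inv a \<otimes> (a \<otimes> b) \<otimes> inv a"
      using c(3) by simp
    also have "\<dots> = b \<otimes> inv a"
      using c(1,2) by (simp add: m_assoc[symmetric])
    finally show ?thesis .
  qed
  then show "inv a \<in> centralizer G B"
    using a by (auto simp: centralizer_def)
next
  fix x y assume x: "x \<in> centralizer G B" and y: "y \<in> centralizer G B"
  have "x \<otimes> y \<otimes> b = b \<otimes> (x \<otimes> y)" if b: "b \<in> B" for b
  proof -
    have c: "x \<in> carrier G" "y \<in> carrier G" "b \<in> carrier G"
      and xb: "x \<otimes> b = b \<otimes> x" and yb: "y \<otimes> b = b \<otimes> y"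
      using x y b assms by (auto simp: centralizer_def)
    have "x \<otimes> y \<otimes> b = x \<otimes> (b \<otimes> y)"
      using c by (simp add: m_assoc yb)
    also have "\<dots> = b \<otimes> x \<otimes> y"
      using c by (simp add: m_assoc[symmetric] xb)
    finally show ?thesis
      using c by (simp add: m_assoc)
  qed
  then show "x \<otimes> y \<in> centralizer G B"
    using x y by (auto simp: centralizer_def)
qed (auto simp: centralizer_def)

theorem (in group) glauberman_solomon_greatest:
  shows "D\<^sup>* G \<lhd> G"
    and "centralizes_normalized_comm G (D\<^sup>* G)"
    and "\<And>E. E \<lhd> G \<Longrightarrow> centralizes_normalized_comm G E \<Longrightarrow> E \<subseteq> D\<^sup>* G"
proof -
  define F where "F = {D. D \<lhd> G \<and> centralizes_normalized_comm G D}"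
  define D where "D = generate G (\<Union>F)"
  have sub: "\<Union>F \<subseteq> carrier G"
    by (auto simp: F_def dest: normal_imp_subgroup subgroup.mem_carrier)
  have normal: "D \<lhd> G"
    unfolding D_def
  proof (rule normal_generateI[OF sub])
    fix h g assume "h \<in> \<Union>F" "g \<in> carrier G"
    then show "g \<otimes> h \<otimes> inv g \<in> \<Union>F"
      by (auto simp: F_def intro: normal.inv_op_closed2)
  qed
  have upper: "E \<subseteq> D" if "E \<in> F" for E
    using that by (auto simp: D_def intro: generate.incl)
  have "D \<subseteq> centralizer G B" if B: "comm_subgroup B G" "D \<subseteq> normalizer G B" for B
  proof -
    have "\<Union>F \<subseteq> centralizer G B"
    proof (rule Union_least)
      fix E assume "E \<in> F"
      then show "E \<subseteq> centralizer G B"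
        using B upper[of E] by (auto simp: F_def centralizes_normalized_comm_def)
    qed
    moreover have "subgroup (centralizer G B) G"
      using B(1) by (intro subgroup_centralizer) (simp add: comm_subgroup_def subgroup.subset)
    ultimately show ?thesis
      unfolding D_def by (rule generate_subgroup_incl)
  qed
  then have centr: "centralizes_normalized_comm G D"
    by (simp add: centralizes_normalized_comm_def)
  have "D\<^sup>* G = D"
    unfolding glauberman_solomon_def
    by (rule Greatest_equality) (use normal centr upper in \<open>auto simp: F_def\<close>)
  then show "D\<^sup>* G \<lhd> G" "centralizes_normalized_comm G (D\<^sup>* G)"
    "\<And>E. E \<lhd> G \<Longrightarrow> centralizes_normalized_comm G E \<Longrightarrow> E \<subseteq> D\<^sup>* G"
    using normal centr upper by (simp_all add: F_def)
qed

end

(* D = D*(S) is abelian: otherwise S fixes some nontrivial coset y Z(D) in D/Z(D) under conjugation, so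
   the coset generates an abelian normal subgroup of S, which D must centralize, forcing y into Z(D).
   If D does not normalize A, put N = N_S(A); a fixed-point argument for N acting on D/(D Int N) gives
   x in D - N that normalizes N. Since D is abelian,
     A' = (A Int x^-1 A x) (D Int A x A x^-1)
   is an abelian subgroup of order |A| normalized by N and x, against the maximality of N.
   So D normalizes A and therefore centralizes it. *)
theory Submission
  imports Defs
begin

section \<open>Conjugation and cosets\<close>

lemma (in group) inv_cancel_left [simp]:
  assumes "x \<in> carrier G" "y \<in> carrier G"
  shows "inv x \<otimes> (x \<otimes> y) = y" "x \<otimes> (inv x \<otimes> y) = y"
  using assms by (simp_all add: m_assoc[symmetric])

lemma (in group) mult_swap_middle:
  assumes "b \<otimes> c = c \<otimes> b" "a \<in> carrier G" "b \<in> carrier G" "c \<in> carrier G" "d \<in> carrier G"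
  shows "(a \<otimes> b) \<otimes> (c \<otimes> d) = (a \<otimes> c) \<otimes> (b \<otimes> d)"
proof -
  have "(a \<otimes> b) \<otimes> (c \<otimes> d) = a \<otimes> (b \<otimes> c) \<otimes> d"
    using assms(2-) by (simp add: m_assoc)
  then show ?thesis
    unfolding assms(1) using assms(2-) by (simp add: m_assoc)
qed

lemma (in group) conjugate_set_eq:
  assumes "H \<subseteq> carrier G" "g \<in> carrier G"
  shows "g <# H #> inv g = (\<lambda>h. g \<otimes> h \<otimes> inv g) ` H"
  by (auto simp: l_coset_def r_coset_def)

text \<open>Conjugation is injective, so a finite set that is mapped into itself is mapped onto
  itself. Later normalizer claims thus reduce to a one-sided closure check.\<close>

lemma (in group) normalizer_iff:
  assumes "H \<subseteq> carrier G" "finite H"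
  shows "g \<in> normalizer G H \<longleftrightarrow> g \<in> carrier G \<and> (\<forall>h\<in>H. g \<otimes> h \<otimes> inv g \<in> H)"
proof -
  have image_iff: "(\<lambda>h. g \<otimes> h \<otimes> inv g) ` H = H \<longleftrightarrow> (\<forall>h\<in>H. g \<otimes> h \<otimes> inv g \<in> H)"
    if g: "g \<in> carrier G"
  proof
    assume "\<forall>h\<in>H. g \<otimes> h \<otimes> inv g \<in> H"
    moreover have "inj_on (\<lambda>h. g \<otimes> h \<otimes> inv g) H"
      using conjugation_is_inj[OF g] assms(1) by (intro inj_onI) (metis subsetD)
    ultimately show "(\<lambda>h. g \<otimes> h \<otimes> inv g) ` H = H"
      by (intro endo_inj_surj assms(2)) auto
  qed auto
  have "g \<in> normalizer G H \<longleftrightarrow> g \<in> carrier G \<and> g <# H #> inv g = H"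
    using assms(1) by (simp add: normalizer_def stabilizer_def)
  also have "\<dots> \<longleftrightarrow> g \<in> carrier G \<and> (\<forall>h\<in>H. g \<otimes> h \<otimes> inv g \<in> H)"
    using image_iff conjugate_set_eq[OF assms(1)] by (intro conj_cong refl) simp
  finally show ?thesis .
qed

lemma comm_subgroupD:
  assumes "comm_subgroup A G"
  shows "subgroup A G" "\<And>a b. a \<in> A \<Longrightarrow> b \<in> A \<Longrightarrow> a \<otimes>\<^bsub>G\<^esub> b = b \<otimes>\<^bsub>G\<^esub> a"
  using assms comm_monoid.m_comm[of "G\<lparr>carrier := A\<rparr>"]
  by (auto simp: comm_subgroup_def comm_group_def)

lemma (in group) comm_subgroupI:
  assumes "subgroup A G" "\<And>a b. a \<in> A \<Longrightarrow> b \<in> A \<Longrightarrow> a \<otimes> b = b \<otimes> a"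
  shows "comm_subgroup A G"
  unfolding comm_subgroup_def
  using assms group.group_comm_groupI[OF subgroup_imp_group[OF assms(1)]] by simp

lemma subset_centralizer_sym:
  assumes "A \<subseteq> carrier G" "B \<subseteq> centralizer G A"
  shows "A \<subseteq> centralizer G B"
proof
  fix a assume a: "a \<in> A"
  have "b \<otimes>\<^bsub>G\<^esub> a = a \<otimes>\<^bsub>G\<^esub> b" if "b \<in> B" for b
    using subsetD[OF assms(2) that] a unfolding centralizer_def by blast
  then show "a \<in> centralizer G B"
    using subsetD[OF assms(1) a] unfolding centralizer_def by simp
qed

text \<open>Centralizers are subgroups and centralizing is symmetric: \<open>H\<close> inside its
  centralizer gives \<open>generate G H\<close> inside the centralizer of \<open>H\<close>. Swapping
  the two roles and generating once more yields commutativity.\<close>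

lemma (in group) comm_subgroup_generate:
  assumes "H \<subseteq> carrier G" "\<And>a b. a \<in> H \<Longrightarrow> b \<in> H \<Longrightarrow> a \<otimes> b = b \<otimes> a"
  shows "comm_subgroup (generate G H) G"
proof (rule comm_subgroupI)
  have gen: "generate G H \<subseteq> carrier G"
    using assms(1) by (rule generate_incl)
  have "H \<subseteq> centralizer G H"
    using assms by (auto simp: centralizer_def)
  then have "generate G H \<subseteq> centralizer G H"
    by (rule generate_subgroup_incl) (rule subgroup_centralizer[OF assms(1)])
  then have "H \<subseteq> centralizer G (generate G H)"
    by (rule subset_centralizer_sym[OF assms(1)])
  then have "generate G H \<subseteq> centralizer G (generate G H)"
    by (rule generate_subgroup_incl) (rule subgroup_centralizer[OF gen])
  then show "a \<otimes> b = b \<otimes> a" if "a \<in> generate G H" "b \<in> generate G H" for a b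
    using that by (auto simp: centralizer_def)
qed (rule generate_is_subgroup[OF assms(1)])

section \<open>Equality and counting of right cosets\<close>

lemma r_coset_eq_image: "H #>\<^bsub>G\<^esub> a = (\<lambda>h. h \<otimes>\<^bsub>G\<^esub> a) ` H"
  by (auto simp: r_coset_def)

lemma (in group) r_coset_eq_iff:
  assumes "subgroup H G" "a \<in> carrier G" "b \<in> carrier G"
  shows "H #> a = H #> b \<longleftrightarrow> a \<otimes> inv b \<in> H"
proof
  assume "H #> a = H #> b"
  then have "a \<in> H #> b"
    using rcos_self[OF assms(2,1)] by simp
  then show "a \<otimes> inv b \<in> H"
    using assms by (auto simp: r_coset_def m_assoc subgroup.mem_carrier)
next
  assume "a \<otimes> inv b \<in> H"
  then have "(a \<otimes> inv b) \<otimes> b \<in> H #> b"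
    by (auto simp: r_coset_def)
  then have "a \<in> H #> b"
    using assms by (simp add: m_assoc)
  then show "H #> a = H #> b"
    using repr_independence[of a H b] assms by simp
qed

lemma (in group) card_cosets_mult:
  assumes "subgroup H G" "subgroup K G" "H \<subseteq> K"
  shows "card ((\<lambda>u. H #> u) ` K) * card H = card K"
proof -
  have "rcosets\<^bsub>G\<lparr>carrier := K\<rparr>\<^esub> H = (\<lambda>u. H #> u) ` K"
    by (auto simp: RCOSETS_def r_coset_def)
  then show ?thesis
    using group.lagrange[OF subgroup_imp_group[OF assms(2)] subgroup_incl[OF assms]]
    by (simp add: order_def)
qed

lemma card_image_le_of_factor:
  assumes "finite A" "\<And>a b. a \<in> A \<Longrightarrow> b \<in> A \<Longrightarrow> f a = f b \<Longrightarrow> g a = g b"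
  shows "card (g ` A) \<le> card (f ` A)"
proof -
  have "g ` A = (g \<circ> inv_into A f) ` f ` A"
  proof -
    have "g a = g (inv_into A f (f a))" if "a \<in> A" for a
      using that by (intro assms(2)) (auto simp: inv_into_into f_inv_into_f)
    then show ?thesis
      by (auto simp: image_image)
  qed
  then show ?thesis
    using assms(1) by (simp add: card_image_le)
qed

section \<open>Fixed points of \<open>p\<close>-groups\<close>

text \<open>Orbit lengths divide \<open>p ^ n\<close>, so every orbit with more than one point has
  length divisible by \<open>p\<close>. Were \<open>x\<close> the only fixed point,
  \<open>card R\<close> would be 1 modulo \<open>p\<close>.\<close>

lemma (in group_action) p_group_other_fixed_point:
  assumes p: "Factorial_Ring.prime p" "order G = p ^ n"
    and R: "R \<subseteq> E" "finite R" "p dvd card R"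
    and closed: "\<And>g x. g \<in> carrier G \<Longrightarrow> x \<in> R \<Longrightarrow> \<phi> g x \<in> R"
    and fixed: "x \<in> R" "\<And>g. g \<in> carrier G \<Longrightarrow> \<phi> g x = x"
  shows "\<exists>y\<in>R - {x}. \<forall>g\<in>carrier G. \<phi> g y = y"
proof (rule ccontr)
  assume "\<not> ?thesis"
  then have nofix: "y \<in> R \<Longrightarrow> y \<noteq> x \<Longrightarrow> \<exists>g\<in>carrier G. \<phi> g y \<noteq> y" for y
    by blast
  \<comment> \<open>An infinite carrier would have \<open>card\<close> equal to 0, so the positive
    order \<open>p ^ n\<close> certifies finiteness.\<close>
  have fin: "finite (carrier G)"
    using p by (intro card_ge_0_finite) (simp add: order_def prime_gt_0_nat)
  have orbit_subset: "orbit G \<phi> y \<subseteq> R" if "y \<in> R" for y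
    using that closed by (auto simp: orbit_def)
  have refl: "y \<in> orbit G \<phi> y" if "y \<in> R" for y
    using that R(1) by (intro orbit_refl) auto
  define \<O> where "\<O> = orbit G \<phi> ` R"
  have disj: "C = C' \<or> C \<inter> C' = {}" if "C \<in> \<O>" "C' \<in> \<O>" for C C'
    using that R(1) by (intro disjoint_union) (auto simp: \<O>_def orbits_def)
  have x_orbit: "orbit G \<phi> x = {x}"
    using fixed refl[of x] by (auto simp: orbit_def)
  have "R = \<Union>\<O>"
    using orbit_subset refl by (auto simp: \<O>_def)
  then have "card R = (\<Sum>C\<in>\<O>. card C)"
    using R(2) disj
    by (metis (no_types, lifting) card_Union_disjoint disjnt_def finite_subset Union_upper pairwise_def)
  \<comment> \<open>The orbit of \<open>x\<close> is split off; it contributes the 1 that ruins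
    divisibility by \<open>p\<close>.\<close>
  also have "\<dots> = card {x} + (\<Sum>C\<in>\<O> - {{x}}. card C)"
    using R(2) fixed(1) x_orbit by (intro sum.remove) (auto simp: \<O>_def image_iff)
  finally have eq: "card R = 1 + (\<Sum>C\<in>\<O> - {{x}}. card C)"
    by simp
  have "p dvd card C" if C: "C \<in> \<O> - {{x}}" for C
  proof -
    obtain y where y: "y \<in> R" "C = orbit G \<phi> y"
      using C by (auto simp: \<O>_def)
    then have "y \<noteq> x"
      using C x_orbit by auto
    have "card C * card (stabilizer G \<phi> y) = p ^ n"
      using orbit_stabilizer_theorem[of y] y R(1) p(2) by auto
    then have "card C dvd p ^ n"
      by (metis dvd_triv_left)
    then obtain k where k: "card C = p ^ k"
      using p(1) by (auto simp: divides_primepow_nat)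
    \<comment> \<open>A one-point orbit would be a fixed point other than \<open>x\<close>. Hence
      the exponent \<open>k\<close> is positive.\<close>
    have "card C \<noteq> 1"
    proof
      assume "card C = 1"
      then have "C = {y}"
        using refl[OF y(1)] y(2) by (auto simp: card_1_singleton_iff)
      then show False
        using nofix[OF y(1) \<open>y \<noteq> x\<close>] y(2) by (auto simp: orbit_def)
    qed
    then show ?thesis
      using k by (cases k) auto
  qed
  then have "p dvd (\<Sum>C\<in>\<O> - {{x}}. card C)"
    by (rule dvd_sum)
  then have "p dvd 1"
    using R(3) eq by (metis dvd_add_left_iff)
  then show False
    using p(1) by (simp add: prime_nat_iff)
qed

text \<open>\<open>P\<close> permutes the right cosets of \<open>V\<close> in \<open>U\<close> by
  conjugation. Their number is a power of \<open>p\<close> greater than 1 and the coset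
  \<open>V\<close> is fixed, so another coset \<open>V #> u\<close> is fixed as well.
  \<open>V\<close> need not be normal in \<open>U\<close>, since cosets are treated as plain
  sets.\<close>

lemma (in group) p_group_normalizes_coset:
  assumes p: "Factorial_Ring.prime p" "finite_p_group p G"
    and P: "subgroup P G" and U: "subgroup U G" and V: "subgroup V G" "V \<subset> U"
    and normU: "\<And>t u. t \<in> P \<Longrightarrow> u \<in> U \<Longrightarrow> t \<otimes> u \<otimes> inv t \<in> U"
    and normV: "\<And>t v. t \<in> P \<Longrightarrow> v \<in> V \<Longrightarrow> t \<otimes> v \<otimes> inv t \<in> V"
  shows "\<exists>u\<in>U - V. \<forall>t\<in>P. t \<otimes> u \<otimes> inv t \<otimes> inv u \<in> V"
proof -
  obtain n where fin: "finite (carrier G)" and n: "order G = p ^ n"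
    using p(2) by (auto simp: finite_p_group_def)
  have p_power: "\<exists>k. card H = p ^ k" if "subgroup H G" for H
    using lagrange[OF that] n p(1) by (metis divides_primepow_nat dvd_triv_right)
  have carr: "t \<in> P \<Longrightarrow> t \<in> carrier G" "u \<in> U \<Longrightarrow> u \<in> carrier G" "v \<in> V \<Longrightarrow> v \<in> carrier G" for t u v
    using P U V(1) by (auto dest: subgroup.mem_carrier)
  define R where "R = (\<lambda>u. V #> u) ` U"
  \<comment> \<open>Conjugation acts on all subsets of the carrier; the coset space \<open>R\<close>
    then only has to be shown invariant.\<close>
  define \<phi> where "\<phi> = (\<lambda>g. \<lambda>H \<in> {H. H \<subseteq> carrier G}. g <# H #> inv g)"
  interpret action: group_action "G\<lparr>carrier := P\<rparr>" "{H. H \<subseteq> carrier G}" \<phi>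
    unfolding \<phi>_def by (rule group_action.induced_action[OF action_by_conjugation_on_power_set P])
  have R_sub: "R \<subseteq> {H. H \<subseteq> carrier G}"
    using r_coset_subset_G[of V] carr by (auto simp: R_def)
  have conj: "\<phi> t (V #> u) = V #> (t \<otimes> u \<otimes> inv t)" if "t \<in> P" "u \<in> U" for t u
  proof -
    have tu: "t \<in> carrier G" "u \<in> carrier G"
      using that carr by auto
    have Vc: "V \<subseteq> carrier G" "V #> u \<subseteq> carrier G"
      using carr tu r_coset_subset_G[of V u] by auto
    have "\<phi> t (V #> u) = (\<lambda>h. t \<otimes> h \<otimes> inv t) ` (V #> u)"
      using tu Vc by (simp add: \<phi>_def conjugate_set_eq)
    also have "\<dots> = (\<lambda>h. t \<otimes> h \<otimes> inv t) ` V #> (t \<otimes> u \<otimes> inv t)"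
    proof -
      have "t \<otimes> (v \<otimes> u) \<otimes> inv t = (t \<otimes> v \<otimes> inv t) \<otimes> (t \<otimes> u \<otimes> inv t)" if "v \<in> V" for v
        using that tu carr(3) by (simp add: m_assoc)
      then have "(\<lambda>h. t \<otimes> (h \<otimes> u) \<otimes> inv t) ` V =
          (\<lambda>h. t \<otimes> h \<otimes> inv t \<otimes> (t \<otimes> u \<otimes> inv t)) ` V"
        by (intro image_cong) auto
      then show ?thesis
        by (simp add: r_coset_eq_image image_image)
    qed
    \<comment> \<open>\<open>normV\<close> gives only inclusion; equality comes from finiteness
      through \<open>normalizer_iff\<close>.\<close>
    also have "(\<lambda>h. t \<otimes> h \<otimes> inv t) ` V = V"
    proof -
      have "t \<in> normalizer G V"
        using that tu normV fin Vc(1) by (subst normalizer_iff) (auto intro: finite_subset)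
      then show ?thesis
        using Vc(1) tu by (auto simp: normalizer_def stabilizer_def conjugate_set_eq)
    qed
    finally show ?thesis .
  qed
  have "p dvd card R"
  proof -
    have "finite U"
      using carr fin by (meson finite_subset subsetI)
    then have "card V < card U"
      using V(2) by (intro psubset_card_mono)
    have mult: "card R * card V = card U"
      unfolding R_def using V U by (intro card_cosets_mult) auto
    obtain k where "card U = p ^ k"
      using p_power[OF U] by blast
    then have "card R dvd p ^ k"
      using mult by (metis dvd_triv_left)
    then obtain j where j: "card R = p ^ j"
      using p(1) by (auto simp: divides_primepow_nat)
    \<comment> \<open>\<open>j = 0\<close> would mean a single coset, hence
      \<open>card V = card U\<close>, although \<open>V\<close> is a proper subset of
      \<open>U\<close>.\<close>
    have "j \<noteq> 0"
      using j mult \<open>card V < card U\<close> by (intro notI) simp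
    then show ?thesis
      using j by simp
  qed
  \<comment> \<open>\<open>V\<close> is the coset of \<open>\<one>\<close>, and conjugation fixes
    \<open>\<one>\<close>.\<close>
  moreover have "\<phi> t V = V" if "t \<in> P" for t
    using conj[OF that, of \<one>] U V(1) that carr subgroup.one_closed[OF U]
    by (simp add: coset_mult_one subgroup.subset)
  moreover have "V \<in> R"
    unfolding R_def using subgroup.one_closed[OF U] coset_mult_one subgroup.subset[OF V(1)]
    by (metis image_eqI)
  moreover obtain k where "order (G\<lparr>carrier := P\<rparr>) = p ^ k"
    using p_power[OF P] by (auto simp: order_def)
  moreover have "finite R"
    unfolding R_def using carr fin by (meson finite_imageI finite_subset subsetI)
  moreover have "\<phi> t C \<in> R" if "t \<in> P" "C \<in> R" for t C
    using that conj normU by (auto simp: R_def)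
  ultimately have "\<exists>C\<in>R - {V}. \<forall>t\<in>carrier (G\<lparr>carrier := P\<rparr>). \<phi> t C = C"
    using R_sub by (intro action.p_group_other_fixed_point[OF p(1)]) auto
  then obtain C where C: "C \<in> R" "C \<noteq> V" "\<And>t. t \<in> P \<Longrightarrow> \<phi> t C = C"
    by auto
  obtain u where u: "u \<in> U" "C = V #> u"
    using C(1) by (auto simp: R_def)
  show ?thesis
  proof (intro bexI ballI DiffI)
    show "u \<notin> V"
      using u C(2) V(1) by (auto simp: subgroup.rcos_const)
    fix t assume t: "t \<in> P"
    then have "V #> (t \<otimes> u \<otimes> inv t) = V #> u"
      using C(3) conj u by simp
    then show "t \<otimes> u \<otimes> inv t \<otimes> inv u \<in> V"
      using t u(1) carr V(1) by (subst (asm) r_coset_eq_iff) auto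
  qed (rule u(1))
qed

section \<open>Commutativity of the Glauberman-Solomon subgroup\<close>

lemma (in group) glauberman_solomon_comm:
  assumes p: "Factorial_Ring.prime p" "finite_p_group p G"
  shows "comm_subgroup (D\<^sup>* G) G"
proof -
  define D where "D = D\<^sup>* G"
  \<comment> \<open>\<open>Z\<close> is the center of \<open>D\<close>, so \<open>D\<close> is
    abelian exactly when \<open>Z = D\<close>.\<close>
  define Z where "Z = D \<inter> centralizer G D"
  have normal: "D \<lhd> G" and centr: "centralizes_normalized_comm G D"
    unfolding D_def by (rule glauberman_solomon_greatest)+
  interpret D: normal D G by (rule normal)
  have fin: "finite (carrier G)"
    using p(2) by (simp add: finite_p_group_def)
  have Z_sub: "subgroup Z G"
    unfolding Z_def by (intro subgroups_Inter_pair D.is_subgroup subgroup_centralizer D.subset)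
  have ZD: "Z \<subseteq> D" and Z_comm: "\<And>z d. z \<in> Z \<Longrightarrow> d \<in> D \<Longrightarrow> z \<otimes> d = d \<otimes> z"
    unfolding Z_def centralizer_def by blast+
  have "Z = D"
  proof (rule ccontr)
    assume "Z \<noteq> D"
    then have "Z \<subset> D"
      using ZD by auto
    have conjZ: "t \<otimes> z \<otimes> inv t \<in> Z" if t: "t \<in> carrier G" and z: "z \<in> Z" for t z
    proof -
      have zD: "z \<in> D" and zc: "z \<in> carrier G"
        using z by (auto simp: Z_def)
      \<comment> \<open>Normality lets \<open>d\<close> be pulled back by \<open>t\<close> into
        \<open>D\<close>, where it commutes with \<open>z\<close>; conjugating back gives the
        claim.\<close>
      have "(t \<otimes> z \<otimes> inv t) \<otimes> d = d \<otimes> (t \<otimes> z \<otimes> inv t)" if d: "d \<in> D" for d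
      proof -
        have dc: "d \<in> carrier G" using d by simp
        have "inv t \<otimes> d \<otimes> t \<in> D"
          using d t by (rule D.inv_op_closed1[rotated])
        then have comm: "z \<otimes> (inv t \<otimes> d \<otimes> t) = (inv t \<otimes> d \<otimes> t) \<otimes> z"
          by (rule Z_comm[OF z])
        have "(t \<otimes> z \<otimes> inv t) \<otimes> d = t \<otimes> (z \<otimes> (inv t \<otimes> d \<otimes> t)) \<otimes> inv t"
          using t zc dc by (simp add: m_assoc)
        also have "\<dots> = d \<otimes> (t \<otimes> z \<otimes> inv t)"
          unfolding comm using t zc dc by (simp add: m_assoc)
        finally show ?thesis .
      qed
      then show ?thesis
        using D.inv_op_closed2[OF t zD] D.subset unfolding Z_def centralizer_def by blast
    qed
    have "\<exists>y\<in>D - Z. \<forall>t\<in>carrier G. t \<otimes> y \<otimes> inv t \<otimes> inv y \<in> Z"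
      by (rule p_group_normalizes_coset[OF p subgroup_self D.is_subgroup Z_sub \<open>Z \<subset> D\<close>])
        (simp_all add: conjZ D.inv_op_closed2)
    then obtain y where y: "y \<in> D" "y \<notin> Z"
      and yZ: "\<And>t. t \<in> carrier G \<Longrightarrow> t \<otimes> y \<otimes> inv t \<otimes> inv y \<in> Z"
      by blast
    have yc: "y \<in> carrier G" and Zc: "Z \<subseteq> carrier G"
      using y(1) Z_sub by (auto dest: subgroup.subset)
    define H where "H = Z #> y"
    have "y \<in> H"
      unfolding H_def using yc Z_sub by (rule rcos_self)
    have Hc: "H \<subseteq> carrier G"
      unfolding H_def using Zc yc by (rule r_coset_subset_G)
    \<comment> \<open>Two elements of the coset differ only in central factors from
      \<open>Z\<close>, and these commute with \<open>y\<close> because \<open>y\<close> lies in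
      \<open>D\<close>.\<close>
    have H_comm: "a \<otimes> b = b \<otimes> a" if "a \<in> H" "b \<in> H" for a b
    proof -
      obtain z w where zw: "z \<in> Z" "w \<in> Z" "a = z \<otimes> y" "b = w \<otimes> y"
        using \<open>a \<in> H\<close> \<open>b \<in> H\<close> unfolding H_def r_coset_def by blast
      have c: "z \<in> carrier G" "w \<in> carrier G" using zw Zc by auto
      have comm: "z \<otimes> y = y \<otimes> z" "w \<otimes> y = y \<otimes> w" "z \<otimes> w = w \<otimes> z"
        using Z_comm zw(1,2) y(1) ZD by blast+
      have "a \<otimes> b = (z \<otimes> w) \<otimes> (y \<otimes> y)"
        unfolding zw(3,4) by (rule mult_swap_middle[OF comm(2)[symmetric] c(1) yc c(2) yc])
      also have "\<dots> = (w \<otimes> z) \<otimes> (y \<otimes> y)"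
        by (simp only: comm(3))
      also have "\<dots> = b \<otimes> a"
        unfolding zw(3,4) by (rule mult_swap_middle[OF comm(1)[symmetric] c(2) yc c(1) yc, symmetric])
      finally show ?thesis .
    qed
    have "generate G H \<lhd> G"
    proof (rule normal_generateI[OF Hc])
      fix h t assume h: "h \<in> H" and t: "t \<in> carrier G"
      obtain z where z: "z \<in> Z" "h = z \<otimes> y"
        using h unfolding H_def r_coset_def by blast
      have zc: "z \<in> carrier G" using z Zc by auto
      \<comment> \<open>The conjugate of \<open>z \<otimes> y\<close> is written as an element of
        \<open>Z\<close> times \<open>y\<close>: one factor lies in \<open>Z\<close> by
        \<open>conjZ\<close>, the commutator of \<open>t\<close> and \<open>y\<close> by the choice
        of \<open>y\<close>.\<close>
      have "t \<otimes> h \<otimes> inv t = ((t \<otimes> z \<otimes> inv t) \<otimes> (t \<otimes> y \<otimes> inv t \<otimes> inv y)) \<otimes> y"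
        using z zc t yc by (simp add: m_assoc)
      then show "t \<otimes> h \<otimes> inv t \<in> H"
        unfolding H_def r_coset_def
        using subgroup.m_closed[OF Z_sub conjZ[OF t z(1)] yZ[OF t]] by blast
    qed
    then have "d \<otimes> h \<otimes> inv d \<in> generate G H" if "d \<in> D" "h \<in> generate G H" for d h
      using that by (intro normal.inv_op_closed2) auto
    then have "D \<subseteq> normalizer G (generate G H)"
      using normalizer_iff[OF generate_incl[OF Hc] finite_subset[OF generate_incl[OF Hc] fin]] by auto
    then have "D \<subseteq> centralizer G (generate G H)"
      using centr comm_subgroup_generate[OF Hc H_comm] by (simp add: centralizes_normalized_comm_def)
    \<comment> \<open>\<open>D\<close> centralizes \<open>generate G H\<close>, so by symmetry
      \<open>y\<close> centralizes \<open>D\<close>; as \<open>y\<close> lies in \<open>D\<close>,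
      it is central there.\<close>
    then have "y \<in> Z"
      using y(1) generate.incl[OF \<open>y \<in> H\<close>, of G] subset_centralizer_sym generate_incl[OF Hc]
      unfolding Z_def by blast
    then show False
      using y(2) by simp
  qed
  then show ?thesis
    unfolding D_def[symmetric] using Z_comm by (intro comm_subgroupI D.is_subgroup) blast
qed

section \<open>Replacement\<close>

text \<open>The commutator hypothesis says that \<open>x\<close> normalizes \<open>N\<close>, the
  normalizer of \<open>A\<close>. Hence the conjugate of \<open>A\<close> by \<open>x\<close> lies
  in \<open>N\<close>, and \<open>B\<close>, the product of \<open>A\<close> with it, is a subgroup.
  The replacement keeps the part \<open>I\<close> of \<open>A\<close> that \<open>x\<close>
  conjugates into \<open>A\<close> and trades the rest for elements of \<open>D\<close>, which
  commute with \<open>x\<close>.\<close>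

lemma (in group) abelian_replacement:
  assumes fin: "finite (carrier G)" and A: "comm_subgroup A G"
    and D: "D \<lhd> G" "comm_subgroup D G"
    and x: "x \<in> D"
    and xN: "\<And>n. n \<in> normalizer G A \<Longrightarrow> n \<otimes> x \<otimes> inv n \<otimes> inv x \<in> normalizer G A"
  obtains A' where "comm_subgroup A' G" "card A' = card A"
    "normalizer G A \<subseteq> normalizer G A'" "x \<in> normalizer G A'"
proof -
  interpret A: subgroup A G using A by (rule comm_subgroupD)
  interpret D: normal D G by (rule D(1))
  note A_comm = comm_subgroupD(2)[OF A] and D_comm = comm_subgroupD(2)[OF D(2)]
  define N where "N = normalizer G A"
  interpret N: subgroup N G
    unfolding N_def by (rule normalizer_imp_subgroup[OF A.subset])
  have finA: "finite A"
    using fin A.subset by (rule finite_subset[rotated])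
  have N_iff: "n \<in> N \<longleftrightarrow> n \<in> carrier G \<and> (\<forall>a\<in>A. n \<otimes> a \<otimes> inv n \<in> A)" for n
    unfolding N_def by (rule normalizer_iff[OF A.subset finA])
  have AN: "A \<subseteq> N"
    by (auto simp: N_iff)
  have xc: "x \<in> carrier G" using x by simp
  have x_conj_N: "x \<otimes> n \<otimes> inv x \<in> N" if n: "n \<in> N" for n
  proof -
    \<comment> \<open>The hypothesis is taken at \<open>inv n\<close>; the product collapses to
      \<open>x \<otimes> n \<otimes> inv x\<close>.\<close>
    have "n \<otimes> (inv n \<otimes> x \<otimes> inv (inv n) \<otimes> inv x) \<in> N"
      using n xN[of "inv n"] by (simp flip: N_def)
    then show ?thesis
      using n xc by (simp add: m_assoc)
  qed
  have finite_N: "finite N"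
    using fin N.subset by (rule finite_subset[rotated])
  have x_norm: "x \<in> normalizer G N"
    using xc x_conj_N N.subset finite_N by (simp add: normalizer_iff)
  have x_inv_conj_N: "inv x \<otimes> n \<otimes> x \<in> N" if n: "n \<in> N" for n
    using subgroup.m_inv_closed[OF normalizer_imp_subgroup[OF N.subset] x_norm] n xc N.subset finite_N
    by (auto simp: normalizer_iff)
  \<comment> \<open>\<open>I\<close> and \<open>E\<close> are the two factors of the replacement \<open>A'\<close>. The commutator map \<open>k\<close> induces a
      bijection between the cosets of \<open>I\<close> in \<open>A\<close> and in \<open>A'\<close>, which gives \<open>card A' = card A\<close>.\<close>
  define I where "I = {a \<in> A. x \<otimes> a \<otimes> inv x \<in> A}"
  define B where "B = {a \<otimes> (x \<otimes> b \<otimes> inv x) | a b. a \<in> A \<and> b \<in> A}"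
  define E where "E = B \<inter> D"
  define A' where "A' = {i \<otimes> e | i e. i \<in> I \<and> e \<in> E}"
  define k where "k = (\<lambda>a. inv a \<otimes> (x \<otimes> a \<otimes> inv x))"
  have IA: "I \<subseteq> A" and ED: "E \<subseteq> D"
    by (auto simp: I_def E_def)
  have k_D: "k a \<in> D" if "a \<in> A" for a
  proof -
    have "(inv a \<otimes> x \<otimes> a) \<otimes> inv x \<in> D"
      using that x by (intro D.m_closed D.m_inv_closed D.inv_op_closed1) auto
    then show ?thesis
      using that xc by (simp add: k_def m_assoc)
  qed
  have k_E: "k a \<in> E" if "a \<in> A" for a
    using k_D[OF that] that unfolding E_def B_def k_def by (auto intro: A.m_inv_closed)
  \<comment> \<open>Such an \<open>a\<close> commutes with \<open>x\<close> since \<open>D\<close>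
    is abelian, so conjugation by \<open>x\<close> fixes it.\<close>
  have AD_I: "a \<in> I" if "a \<in> A" "a \<in> D" for a
    using that xc D_comm[OF x that(2)] by (simp add: I_def m_assoc)
  \<comment> \<open>Absorbing \<open>b\<close> into the first factor leaves \<open>k b\<close>,
    which lies in \<open>D\<close>; since \<open>e\<close> does too, so does the remaining factor
    \<open>a \<otimes> b\<close>.\<close>
  have E_decomp: "\<exists>d b. d \<in> A \<inter> D \<and> b \<in> A \<and> e = d \<otimes> k b" if "e \<in> E" for e
  proof -
    obtain a b where ab: "a \<in> A" "b \<in> A" "e = a \<otimes> (x \<otimes> b \<otimes> inv x)" and e: "e \<in> D"
      using \<open>e \<in> E\<close> by (auto simp: E_def B_def)
    have eq: "e = (a \<otimes> b) \<otimes> k b"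
      using ab xc by (simp add: k_def m_assoc)
    then have "a \<otimes> b = e \<otimes> inv (k b)"
      using ab e k_D[of b] by (simp add: m_assoc)
    then have "a \<otimes> b \<in> D"
      using e k_D[OF ab(2)] by simp
    then show ?thesis
      using eq ab by blast
  qed
  \<comment> \<open>\<open>I\<close> centralizes \<open>B\<close>. The commutator \<open>m\<close>
    of \<open>x\<close> and \<open>i\<close> lies in both \<open>A\<close> and \<open>D\<close>, so
    it commutes with \<open>b\<close> and \<open>x\<close>, hence with \<open>b'\<close>. The
    conjugate \<open>y\<close> of \<open>i\<close> commutes with \<open>b'\<close> because
    \<open>i\<close> commutes with \<open>b\<close>. As \<open>y = m \<otimes> i\<close>, so does
    \<open>i\<close>.\<close>
  have I_central: "i \<otimes> (a \<otimes> (x \<otimes> b \<otimes> inv x)) = (a \<otimes> (x \<otimes> b \<otimes> inv x)) \<otimes> i"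
    if i: "i \<in> I" and a: "a \<in> A" and b: "b \<in> A" for i a b
  proof -
    define y where "y = x \<otimes> i \<otimes> inv x"
    define m where "m = y \<otimes> inv i"
    define b' where "b' = x \<otimes> b \<otimes> inv x"
    have A: "i \<in> A" "y \<in> A"
      using i by (auto simp: I_def y_def)
    then have mA: "m \<in> A"
      by (simp add: m_def)
    have c: "i \<in> carrier G" "y \<in> carrier G" "m \<in> carrier G" "a \<in> carrier G" "b \<in> carrier G"
      "b' \<in> carrier G"
      using A mA a b xc by (auto simp: b'_def)
    have "x \<otimes> (i \<otimes> inv x \<otimes> inv i) \<in> D"
      using x c(1) by (intro D.m_closed D.inv_op_closed2) auto
    then have mD: "m \<in> D"
      using c(1) xc by (simp add: m_def y_def m_assoc)
    have mb: "m \<otimes> b = b \<otimes> m" and mx: "m \<otimes> x = x \<otimes> m" and mx': "m \<otimes> inv x = inv x \<otimes> m"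
      using A_comm[OF mA b] D_comm[OF mD] x by simp_all
    have "m \<otimes> b' = (m \<otimes> x) \<otimes> b \<otimes> inv x"
      using c xc by (simp add: b'_def m_assoc)
    also have "\<dots> = x \<otimes> (m \<otimes> b) \<otimes> inv x"
      using c xc by (simp add: mx m_assoc)
    also have "\<dots> = x \<otimes> b \<otimes> (m \<otimes> inv x)"
      using c xc by (simp add: mb m_assoc)
    also have "\<dots> = b' \<otimes> m"
      using c xc by (simp add: mx' b'_def m_assoc)
    finally have mb': "m \<otimes> b' = b' \<otimes> m" .
    have "y \<otimes> b' = x \<otimes> (i \<otimes> b) \<otimes> inv x"
      using c xc by (simp add: y_def b'_def m_assoc)
    also have "\<dots> = b' \<otimes> y"
      unfolding A_comm[OF A(1) b] using c xc by (simp add: y_def b'_def m_assoc)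
    finally have yb': "y \<otimes> b' = b' \<otimes> y" .
    have mi: "m \<otimes> i = y"
      using c by (simp add: m_def m_assoc)
    have "m \<otimes> (i \<otimes> b') = (m \<otimes> i) \<otimes> b'"
      using c by (simp add: m_assoc)
    also have "\<dots> = (b' \<otimes> m) \<otimes> i"
      using c by (simp add: mi yb' m_assoc)
    also have "\<dots> = m \<otimes> (b' \<otimes> i)"
      using c by (simp add: m_assoc flip: mb')
    finally have ib': "i \<otimes> b' = b' \<otimes> i"
      using c by simp
    have "i \<otimes> (a \<otimes> b') = (i \<otimes> a) \<otimes> b'"
      using c by (simp add: m_assoc)
    also have "\<dots> = a \<otimes> b' \<otimes> i"
      unfolding A_comm[OF A(1) a] using c by (simp add: m_assoc ib')
    finally show ?thesis
      by (simp add: b'_def)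
  qed
  have IE_comm: "i \<otimes> e = e \<otimes> i" if "i \<in> I" "e \<in> E" for i e
    using that I_central by (auto simp: E_def B_def)
  have I_sub: "subgroup I G"
  proof (rule subgroupI)
    show "I \<noteq> {}" using AD_I[of \<one>] by auto
    show "inv a \<in> I" if "a \<in> I" for a
      using that xc A.m_inv_closed[of "x \<otimes> a \<otimes> inv x"]
      by (auto simp: I_def inv_mult_group m_assoc)
    show "a \<otimes> b \<in> I" if "a \<in> I" "b \<in> I" for a b
      using that xc A.m_closed[of "x \<otimes> a \<otimes> inv x" "x \<otimes> b \<otimes> inv x"]
      by (auto simp: I_def m_assoc)
  qed (auto simp: I_def)
  have B_sub: "subgroup B G"
  proof (rule subgroupI)
    show "B \<subseteq> carrier G" using xc by (auto simp: B_def)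
    show "B \<noteq> {}" unfolding B_def using A.one_closed by blast
    show "inv g \<in> B" if "g \<in> B" for g
    proof -
      obtain a b where ab: "a \<in> A" "b \<in> A" "g = a \<otimes> (x \<otimes> b \<otimes> inv x)"
        using \<open>g \<in> B\<close> by (auto simp: B_def)
      define b' where "b' = x \<otimes> inv b \<otimes> inv x"
      have b': "b' \<in> N"
        using ab AN by (auto simp: b'_def intro!: x_conj_N)
      \<comment> \<open>Inversion reverses the factors; \<open>b'\<close> lies in \<open>N\<close>
        and so can be moved past \<open>inv a\<close> at the cost of conjugating it inside
        \<open>A\<close>.\<close>
      then have "inv g = (b' \<otimes> inv a \<otimes> inv b') \<otimes> b'"
        using ab xc by (simp add: m_assoc inv_mult_group) (simp add: b'_def m_assoc)
      moreover have "b' \<otimes> inv a \<otimes> inv b' \<in> A"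
        using b' ab by (simp add: N_iff)
      ultimately show ?thesis
        unfolding B_def b'_def using ab by blast
    qed
    show "g \<otimes> h \<in> B" if "g \<in> B" "h \<in> B" for g h
    proof -
      obtain a b where ab: "a \<in> A" "b \<in> A" "g = a \<otimes> (x \<otimes> b \<otimes> inv x)"
        using \<open>g \<in> B\<close> by (auto simp: B_def)
      obtain c d where cd: "c \<in> A" "d \<in> A" "h = c \<otimes> (x \<otimes> d \<otimes> inv x)"
        using \<open>h \<in> B\<close> by (auto simp: B_def)
      define b' where "b' = x \<otimes> b \<otimes> inv x"
      have b': "b' \<in> N"
        using ab AN by (auto simp: b'_def intro!: x_conj_N)
      have "g \<otimes> h = (a \<otimes> (b' \<otimes> c \<otimes> inv b')) \<otimes> (b' \<otimes> (x \<otimes> d \<otimes> inv x))"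
        using ab cd xc N.mem_carrier[OF b'] by (simp add: m_assoc flip: b'_def)
      also have "b' \<otimes> (x \<otimes> d \<otimes> inv x) = x \<otimes> (b \<otimes> d) \<otimes> inv x"
        using ab cd xc by (simp add: b'_def m_assoc)
      finally have "g \<otimes> h = (a \<otimes> (b' \<otimes> c \<otimes> inv b')) \<otimes> (x \<otimes> (b \<otimes> d) \<otimes> inv x)" .
      moreover have "a \<otimes> (b' \<otimes> c \<otimes> inv b') \<in> A"
        using b' ab cd by (simp add: N_iff)
      ultimately show ?thesis
        unfolding B_def using ab cd by blast
    qed
  qed
  have E_sub: "subgroup E G"
    unfolding E_def by (intro subgroups_Inter_pair B_sub D.is_subgroup)
  interpret I: subgroup I G by (rule I_sub)
  interpret E: subgroup E G by (rule E_sub)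
  have IE_mult: "(i \<otimes> e) \<otimes> (j \<otimes> f) = (i \<otimes> j) \<otimes> (e \<otimes> f)"
    if "i \<in> I" "e \<in> E" "j \<in> I" "f \<in> E" for i e j f
    using that IE_comm[of j e] by (intro mult_swap_middle) auto
  have A'_sub: "subgroup A' G"
  proof (rule subgroupI)
    show "A' \<subseteq> carrier G" by (auto simp: A'_def)
    show "A' \<noteq> {}" unfolding A'_def using I.one_closed E.one_closed by blast
    show "inv g \<in> A'" if "g \<in> A'" for g
    proof -
      obtain i e where ie: "i \<in> I" "e \<in> E" "g = i \<otimes> e"
        using \<open>g \<in> A'\<close> by (auto simp: A'_def)
      then have "inv g = inv i \<otimes> inv e"
        using IE_comm[of i e] by (simp add: inv_mult_group)
      then show ?thesis
        unfolding A'_def using ie by blast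
    qed
    show "g \<otimes> h \<in> A'" if "g \<in> A'" "h \<in> A'" for g h
    proof -
      obtain i e where ie: "i \<in> I" "e \<in> E" "g = i \<otimes> e"
        using \<open>g \<in> A'\<close> by (auto simp: A'_def)
      obtain j f where jf: "j \<in> I" "f \<in> E" "h = j \<otimes> f"
        using \<open>h \<in> A'\<close> by (auto simp: A'_def)
      then have "g \<otimes> h = (i \<otimes> j) \<otimes> (e \<otimes> f)"
        using ie IE_mult by simp
      then show ?thesis
        unfolding A'_def using ie jf by blast
    qed
  qed
  interpret A': subgroup A' G by (rule A'_sub)
  have I_A': "I \<subseteq> A'"
  proof
    show "i \<in> A'" if "i \<in> I" for i
      unfolding A'_def using that by (intro CollectI exI[of _ i] exI[of _ \<one>]) simp
  qed
  have E_A': "E \<subseteq> A'"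
  proof
    show "e \<in> A'" if "e \<in> E" for e
      unfolding A'_def using that by (intro CollectI exI[of _ \<one>] exI[of _ e]) simp
  qed
  have "comm_subgroup A' G"
  proof (rule comm_subgroupI[OF A'_sub])
    fix g h assume "g \<in> A'" "h \<in> A'"
    obtain i e where ie: "i \<in> I" "e \<in> E" "g = i \<otimes> e"
      using \<open>g \<in> A'\<close> by (auto simp: A'_def)
    obtain j f where jf: "j \<in> I" "f \<in> E" "h = j \<otimes> f"
      using \<open>h \<in> A'\<close> by (auto simp: A'_def)
    have "g \<otimes> h = (i \<otimes> j) \<otimes> (e \<otimes> f)"
      using ie jf IE_mult by simp
    also have "\<dots> = (j \<otimes> i) \<otimes> (f \<otimes> e)"
      using A_comm[of i j] D_comm[of e f] ie jf IA ED by (simp add: subset_iff)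
    also have "\<dots> = h \<otimes> g"
      using ie jf IE_mult[of j f i e] by simp
    finally show "g \<otimes> h = h \<otimes> g" .
  qed
  moreover have "card A' = card A"
  proof -
    \<comment> \<open>The quotient of \<open>k a\<close> and \<open>k b\<close> is \<open>y\<close>,
      the conjugate of \<open>a \<otimes> inv b\<close> by \<open>x\<close>, multiplied on both
      sides by elements of \<open>A\<close>. It therefore lies in \<open>A\<close> exactly when
      \<open>a \<otimes> inv b\<close> lies in \<open>I\<close>.\<close>
    have eq_iff: "I #> a = I #> b \<longleftrightarrow> I #> k a = I #> k b" if ab: "a \<in> A" "b \<in> A" for a b
    proof -
      define y where "y = x \<otimes> (a \<otimes> inv b) \<otimes> inv x"
      have c: "k a \<in> carrier G" "k b \<in> carrier G" "y \<in> carrier G"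
        using k_D ab xc by (auto simp: y_def)
      have eq: "k a \<otimes> inv (k b) = inv a \<otimes> y \<otimes> b"
        using ab xc by (simp add: k_def y_def m_assoc inv_mult_group)
      have "I #> k a = I #> k b \<longleftrightarrow> k a \<otimes> inv (k b) \<in> I"
        using c by (simp add: r_coset_eq_iff[OF I_sub])
      \<comment> \<open>The element already lies in \<open>D\<close>, and
        \<open>A \<inter> D\<close> is contained in \<open>I\<close>, so membership in
        \<open>I\<close> amounts to membership in \<open>A\<close>.\<close>
      also have "\<dots> \<longleftrightarrow> inv a \<otimes> y \<otimes> b \<in> A"
        using AD_I[of "k a \<otimes> inv (k b)"] IA k_D ab unfolding eq[symmetric] by auto
      also have "\<dots> \<longleftrightarrow> y \<in> A"
      proof
        assume "inv a \<otimes> y \<otimes> b \<in> A"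
        then have "a \<otimes> (inv a \<otimes> y \<otimes> b) \<otimes> inv b \<in> A"
          using ab by simp
        then show "y \<in> A"
          using ab c by (simp add: m_assoc)
      qed (use ab in simp)
      also have "\<dots> \<longleftrightarrow> a \<otimes> inv b \<in> I"
        using ab by (simp add: I_def y_def)
      also have "\<dots> \<longleftrightarrow> I #> a = I #> b"
        using ab by (simp add: r_coset_eq_iff[OF I_sub])
      finally show ?thesis ..
    qed
    \<comment> \<open>In \<open>i \<otimes> e\<close> with \<open>e = d \<otimes> k b\<close>, the
      factor \<open>d\<close> belongs to \<open>I\<close> by \<open>AD_I\<close>; so every coset of
      \<open>I\<close> in \<open>A'\<close> has a representative \<open>k b\<close>.\<close>
    have surj: "(\<lambda>g. I #> g) ` A' = (\<lambda>a. I #> k a) ` A"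
    proof
      show "(\<lambda>g. I #> g) ` A' \<subseteq> (\<lambda>a. I #> k a) ` A"
      proof safe
        fix g assume "g \<in> A'"
        then obtain i e where ie: "i \<in> I" "e \<in> E" "g = i \<otimes> e"
          by (auto simp: A'_def)
        obtain d b where db: "d \<in> A" "d \<in> D" "b \<in> A" "e = d \<otimes> k b"
          using E_decomp[OF ie(2)] by auto
        have "i \<otimes> d \<in> I"
          using ie db AD_I by simp
        moreover have "g = (i \<otimes> d) \<otimes> k b"
          using ie db k_D[OF db(3)] by (simp add: m_assoc)
        ultimately have "g \<otimes> inv (k b) \<in> I"
          using k_D[OF db(3)] by (simp add: m_assoc)
        then have "I #> g = I #> k b"
          using \<open>g \<in> A'\<close> k_D[OF db(3)] by (simp add: r_coset_eq_iff[OF I_sub])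
        then show "I #> g \<in> (\<lambda>a. I #> k a) ` A"
          using db(3) by blast
      qed
      show "(\<lambda>a. I #> k a) ` A \<subseteq> (\<lambda>g. I #> g) ` A'"
        using k_E E_A' by auto
    qed
    have "card ((\<lambda>a. I #> k a) ` A) = card ((\<lambda>a. I #> a) ` A)"
      using finA eq_iff by (intro antisym card_image_le_of_factor) auto
    then show ?thesis
      using card_cosets_mult[OF I_sub A'_sub I_A'] card_cosets_mult[OF I_sub A.is_subgroup IA] surj
      by simp
  qed
  moreover have finA': "finite A'"
    using fin A'.subset by (rule finite_subset[rotated])
  moreover have "N \<subseteq> normalizer G A'"
  proof
    fix n assume n: "n \<in> N"
    have nc: "n \<in> carrier G" using n by simp
    have nA: "n \<otimes> a \<otimes> inv n \<in> A" if "a \<in> A" for a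
      using n that by (simp add: N_iff)
    \<comment> \<open>Conjugation by \<open>n\<close> passes through that by \<open>x\<close> once
      \<open>n\<close> is replaced by \<open>inv x \<otimes> n \<otimes> x\<close>, again in
      \<open>N\<close>. So \<open>n\<close> also normalizes the conjugate of \<open>A\<close> by
      \<open>x\<close>.\<close>
    have nx: "n \<otimes> (x \<otimes> a \<otimes> inv x) \<otimes> inv n =
        x \<otimes> ((inv x \<otimes> n \<otimes> x) \<otimes> a \<otimes> inv (inv x \<otimes> n \<otimes> x)) \<otimes> inv x" if "a \<in> A" for a
      using that nc xc by (simp add: m_assoc inv_mult_group)
    have nB: "n \<otimes> g \<otimes> inv n \<in> B" if g: "g \<in> B" for g
    proof -
      obtain a b where ab: "a \<in> A" "b \<in> A" "g = a \<otimes> (x \<otimes> b \<otimes> inv x)"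
        using g by (auto simp: B_def)
      have "n \<otimes> g \<otimes> inv n = (n \<otimes> a \<otimes> inv n) \<otimes> (n \<otimes> (x \<otimes> b \<otimes> inv x) \<otimes> inv n)"
        using ab nc xc by (simp add: m_assoc)
      moreover have "(inv x \<otimes> n \<otimes> x) \<otimes> b \<otimes> inv (inv x \<otimes> n \<otimes> x) \<in> A"
        using x_inv_conj_N[OF n] ab(2) unfolding N_iff by blast
      ultimately show ?thesis
        unfolding B_def nx[OF ab(2)] using nA[OF ab(1)] by blast
    qed
    have nI: "n \<otimes> i \<otimes> inv n \<in> I" if i: "i \<in> I" for i
    proof -
      define m where "m = x \<otimes> n \<otimes> inv x"
      have "m \<in> N"
        unfolding m_def using n by (rule x_conj_N)
      then have "m \<otimes> (x \<otimes> i \<otimes> inv x) \<otimes> inv m \<in> A"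
        using i unfolding N_iff I_def by blast
      also have "m \<otimes> (x \<otimes> i \<otimes> inv x) \<otimes> inv m = x \<otimes> (n \<otimes> i \<otimes> inv n) \<otimes> inv x"
        using i nc xc by (simp add: m_def m_assoc inv_mult_group)
      finally show ?thesis
        using i nA by (simp add: I_def)
    qed
    have "n \<otimes> g \<otimes> inv n \<in> A'" if g: "g \<in> A'" for g
    proof -
      obtain i e where ie: "i \<in> I" "e \<in> E" "g = i \<otimes> e"
        using g by (auto simp: A'_def)
      have "n \<otimes> g \<otimes> inv n = (n \<otimes> i \<otimes> inv n) \<otimes> (n \<otimes> e \<otimes> inv n)"
        using ie nc by (simp add: m_assoc)
      moreover have "n \<otimes> e \<otimes> inv n \<in> E"
        using ie(2) nB nc by (auto simp: E_def intro: D.inv_op_closed2)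
      ultimately show ?thesis
        unfolding A'_def using nI[OF ie(1)] by blast
    qed
    then show "n \<in> normalizer G A'"
      using nc A'.subset finA' by (simp add: normalizer_iff)
  qed
  moreover have "x \<in> normalizer G A'"
  proof -
    have "x \<otimes> g \<otimes> inv x \<in> A'" if g: "g \<in> A'" for g
    proof -
      obtain i e where ie: "i \<in> I" "e \<in> E" "g = i \<otimes> e"
        using g by (auto simp: A'_def)
      have "x \<otimes> g \<otimes> inv x = x \<otimes> i \<otimes> (e \<otimes> inv x)"
        using ie xc by (simp add: m_assoc)
      also have "e \<otimes> inv x = inv x \<otimes> e"
        using ie(2) ED x by (intro D_comm) auto
      \<comment> \<open>Conjugation by \<open>x\<close> fixes \<open>e\<close> and multiplies
        \<open>i\<close> by \<open>k i\<close>, an element of \<open>E\<close>; the result stays in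
        \<open>A'\<close>.\<close>
      also have "x \<otimes> i \<otimes> (inv x \<otimes> e) = i \<otimes> (k i \<otimes> e)"
        using ie xc by (simp add: k_def m_assoc)
      finally show ?thesis
        unfolding A'_def using ie k_E IA by blast
    qed
    then show ?thesis
      using xc A'.subset finA' by (simp add: normalizer_iff)
  qed
  ultimately show thesis
    by (intro that) (simp_all add: N_def)
qed

section \<open>From maximality of the normalizer to centralization\<close>

theorem theorem5p4:
  fixes S :: "('a, 'b) monoid_scheme" and p :: nat and A :: "'a set"
  assumes "Factorial_Ring.prime p"
    and "finite_p_group p S"
    and "comm_subgroup A S"
    and "\<And>A'. comm_subgroup A' S \<Longrightarrow> card A' = card A \<Longrightarrow>
           normalizer S A \<subseteq> normalizer S A' \<Longrightarrow> normalizer S A' = normalizer S A"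
  shows "A \<subseteq> centralizer S (D\<^sup>* S)"
proof -
  interpret group S
    using assms(2) by (simp add: finite_p_group_def)
  have fin: "finite (carrier S)"
    using assms(2) by (simp add: finite_p_group_def)
  define D where "D = D\<^sup>* S"
  have D: "D \<lhd> S" "centralizes_normalized_comm S D" "comm_subgroup D S"
    unfolding D_def using glauberman_solomon_greatest glauberman_solomon_comm[OF assms(1,2)] by auto
  interpret D: normal D S by (rule D(1))
  interpret A: subgroup A S using assms(3) by (rule comm_subgroupD)
  define N where "N = normalizer S A"
  interpret N: subgroup N S
    unfolding N_def by (rule normalizer_imp_subgroup[OF A.subset])
  have "D \<subseteq> N"
  proof (rule ccontr)
    assume "\<not> D \<subseteq> N"
    then have "D \<inter> N \<subset> D" by auto
    \<comment> \<open>\<open>N\<close> acts on the cosets of \<open>D \<inter> N\<close> in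
      \<open>D\<close>; a second fixed coset supplies an element outside \<open>N\<close> that
      normalizes \<open>N\<close>.\<close>
    have "\<exists>x\<in>D - D \<inter> N. \<forall>n\<in>N. n \<otimes>\<^bsub>S\<^esub> x \<otimes>\<^bsub>S\<^esub> inv\<^bsub>S\<^esub> n \<otimes>\<^bsub>S\<^esub> inv\<^bsub>S\<^esub> x \<in> D \<inter> N"
      by (rule p_group_normalizes_coset[OF assms(1,2) N.subgroup_axioms D.is_subgroup
            subgroups_Inter_pair[OF D.is_subgroup N.subgroup_axioms] \<open>D \<inter> N \<subset> D\<close>])
        (simp_all add: D.inv_op_closed2)
    then obtain x where x: "x \<in> D" "x \<notin> N"
      "\<And>n. n \<in> N \<Longrightarrow> n \<otimes>\<^bsub>S\<^esub> x \<otimes>\<^bsub>S\<^esub> inv\<^bsub>S\<^esub> n \<otimes>\<^bsub>S\<^esub> inv\<^bsub>S\<^esub> x \<in> N"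
      by blast
    have xN: "n \<otimes>\<^bsub>S\<^esub> x \<otimes>\<^bsub>S\<^esub> inv\<^bsub>S\<^esub> n \<otimes>\<^bsub>S\<^esub> inv\<^bsub>S\<^esub> x \<in> normalizer S A" if "n \<in> normalizer S A" for n
      using x(3)[of n] that unfolding N_def by blast
    obtain A' where A': "comm_subgroup A' S" "card A' = card A"
        "normalizer S A \<subseteq> normalizer S A'" "x \<in> normalizer S A'"
      using xN by (rule abelian_replacement[OF fin assms(3) D(1,3) x(1)]) blast+
    \<comment> \<open>Maximality turns the inclusion of normalizers into equality, so
      \<open>x\<close>, which normalizes \<open>A'\<close>, also normalizes
      \<open>A\<close>.\<close>
    have "x \<in> N"
      using A'(4) unfolding N_def assms(4)[OF A'(1,2,3)] .
    then show False
      using x(1,2) by simp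
  qed
  then have "D \<subseteq> centralizer S A"
    using D(2) assms(3) by (simp add: centralizes_normalized_comm_def N_def)
  then show ?thesis
    unfolding D_def by (rule subset_centralizer_sym[OF A.subset])
qed

end
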